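(* Let $k,t\geq 2$ be integers. Then $$\mathrm{gpn}(G_{k,t})=\frac{1}{k-1}\left(\frac{k^{t+2}-k^{3}}{k-1}+k^{3}(k-2)(t-1)\right)+kt.$$
   Context: For distinct vertices $u,v$ of a connected simple graph $G$, $\mathrm{gpn}_G(u,v)$ denotes the number of shortest $u$–$v$ paths in $G$, and for a graph $G$ on $n$ vertices $\mathrm{gpn}(G)=\sum_{\{u,v\}\subseteq V(G),\,u\neq v}\mathrm{gpn}_G(u,v)+n$ (sum over unordered pairs of distinct vertices). $D_k$ denotes the discrete (edgeless) graph on $k$ vertices. $G_{k,t}$ is the sequential join of $t$ copies of $D_k$: take $t$ disjoint copies of $D_k$, indexed $1,\ldots,t$, and for every $i\in\{1,\ldots,t-1\}$ add all edges between the $i$-th copy and the $(i+1)$-th copy (and no other edges). *)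

theory Defs
  imports Complex_Main "Graph_Theory.Graph_Theory"
begin

text \<open>
  A finite simple graph is a \<^locale>\<open>pair_graph\<close>: a finite, loop-free digraph without
  parallel arcs in which every edge \<open>uv\<close> is represented by the two arcs \<open>(u,v)\<close> and \<open>(v,u)\<close>.
  A path from \<open>u\<close> to \<open>v\<close> is a list of arcs, so for \<open>u \<noteq> v\<close> the paths from \<open>u\<close> to \<open>v\<close> correspond
  bijectively to the undirected paths joining \<open>u\<close> and \<open>v\<close>.
\<close>

definition shortest_path :: "'a pair_pre_digraph \<Rightarrow> 'a \<Rightarrow> ('a \<times> 'a) awalk \<Rightarrow> 'a \<Rightarrow> bool" where
  "shortest_path G u p v \<longleftrightarrow>
     is_arg_min length (\<lambda>q. pre_digraph.apath (with_proj G) u q v) p"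

definition gpn_between :: "'a pair_pre_digraph \<Rightarrow> 'a \<Rightarrow> 'a \<Rightarrow> nat" where
  "gpn_between G u v = card {p. shortest_path G u p v}"

text \<open>
  The value of \<^const>\<open>gpn_between\<close> on an unordered pair \<open>e = {u, v}\<close>. It does not depend on
  the order of \<open>u\<close> and \<open>v\<close> if \<open>G\<close> is symmetric; see \<open>gpn_pair_eq\<close> below.
\<close>

definition gpn_pair :: "'a pair_pre_digraph \<Rightarrow> 'a set \<Rightarrow> nat" where
  "gpn_pair G e = (THE m. \<exists>u v. e = {u, v} \<and> m = gpn_between G u v)"

definition gpn :: "'a pair_pre_digraph \<Rightarrow> nat" where
  "gpn G = (\<Sum>e | e \<subseteq> pverts G \<and> card e = 2. gpn_pair G e) + card (pverts G)"

definition discrete_graph :: "nat \<Rightarrow> nat pair_pre_digraph" where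
  "discrete_graph k = \<lparr> pverts = {..<k}, parcs = {} \<rparr>"

text \<open>
  The sequential join of \<open>H 1, \<dots>, H t\<close>; the vertex \<open>(i, a)\<close> is the vertex \<open>a\<close> of the
  \<open>i\<close>-th graph.
\<close>

definition sequential_join :: "nat \<Rightarrow> (nat \<Rightarrow> 'a pair_pre_digraph) \<Rightarrow> (nat \<times> 'a) pair_pre_digraph"
  where
  "sequential_join t H =
     \<lparr> pverts = (SIGMA i:{1..t}. pverts (H i)),
       parcs =
         {((i, a), (i, b)) | i a b. i \<in> {1..t} \<and> (a, b) \<in> parcs (H i)} \<union>
         {((i, a), (j, b)) | i j a b. i \<in> {1..t} \<and> j \<in> {1..t} \<and> (j = i + 1 \<or> i = j + 1) \<and>
            a \<in> pverts (H i) \<and> b \<in> pverts (H j)} \<rparr>"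

definition join_discrete :: "nat \<Rightarrow> nat \<Rightarrow> (nat \<times> nat) pair_pre_digraph" where
  "join_discrete k t = sequential_join t (\<lambda>_. discrete_graph k)"


lemma (in pair_sym_digraph) gpn_between_sym: "gpn_between G u v = gpn_between G v u"
proof -
  have *: "shortest_path G y (rev_path p) x" if "shortest_path G x p y" for x y p
  proof -
    have len: "length (rev_path q) = length q" for q :: "('a \<times> 'a) awalk"
      by (induction q) auto
    have "apath x (rev_path q) y" if "apath y q x" for q
      using that by simp
    then show ?thesis
      using that len unfolding shortest_path_def is_arg_min_def
      by (metis apath_rev_path)
  qed
  have "bij_betw rev_path {p. shortest_path G u p v} {p. shortest_path G v p u}"
    by (rule bij_betwI[where g = rev_path]) (auto intro: *)
  then show ?thesis
    unfolding gpn_between_def by (rule bij_betw_same_card)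
qed

lemma (in pair_sym_digraph) gpn_pair_eq: "gpn_pair G {u, v} = gpn_between G u v"
  unfolding gpn_pair_def
  by (rule the_equality) (auto simp: doubleton_eq_iff gpn_between_sym)

lemma pverts_join_discrete: "pverts (join_discrete k t) = {1..t} \<times> {..<k}"
  by (auto simp: join_discrete_def sequential_join_def discrete_graph_def)

lemma in_parcs_join_discrete_iff:
  "((i, a), (j, b)) \<in> parcs (join_discrete k t) \<longleftrightarrow>
     i \<in> {1..t} \<and> j \<in> {1..t} \<and> a < k \<and> b < k \<and> (j = i + 1 \<or> i = j + 1)"
  by (auto simp: join_discrete_def sequential_join_def discrete_graph_def)

lemma pair_graph_join_discrete: "pair_graph (join_discrete k t)"
proof -
  have *: "parcs (join_discrete k t) \<subseteq> ({1..t} \<times> {..<k}) \<times> ({1..t} \<times> {..<k})"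
    by (auto simp: in_parcs_join_discrete_iff)
  show ?thesis
  proof
    show "finite (parcs (join_discrete k t))"
      by (rule finite_subset[OF *]) simp
    show "symmetric (with_proj (join_discrete k t))"
      by (auto simp: symmetric_def sym_def in_parcs_join_discrete_iff)
  qed (use * in \<open>auto simp: pverts_join_discrete in_parcs_join_discrete_iff\<close>)
qed

lemma connected_join_discrete:
  assumes "k \<ge> 1" "t \<ge> 2"
  shows "connected (with_proj (join_discrete k t))"
proof -
  let ?G = "join_discrete k t"
  interpret pair_graph ?G by (rule pair_graph_join_discrete)
  have arc: "x \<rightarrow>\<^sup>*\<^bsub>with_proj ?G\<^esub> y" if "(x, y) \<in> parcs ?G" for x y
    using that by (intro adj_reachable_trans[OF _ reachable_refl]) (auto dest: wellformed')
  have sym: "y \<rightarrow>\<^sup>*\<^bsub>with_proj ?G\<^esub> x" if "x \<rightarrow>\<^sup>*\<^bsub>with_proj ?G\<^esub> y" for x y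
    using that sym_arcs by (metis symmetric_reachable)
  have base: "(1, 0) \<rightarrow>\<^sup>*\<^bsub>with_proj ?G\<^esub> (i, a)" if "1 \<le> i" "i \<le> t" "a < k" for i a
    using that
  proof (induction i arbitrary: a rule: dec_induct)
    case base
    have "(1, 0) \<rightarrow>\<^sup>*\<^bsub>with_proj ?G\<^esub> (2, 0)" "(2, 0) \<rightarrow>\<^sup>*\<^bsub>with_proj ?G\<^esub> (1, a)"
      using base assms by (auto intro!: arc simp: in_parcs_join_discrete_iff)
    then show ?case by (rule reachable_trans)
  next
    case (step i)
    have "(1, 0) \<rightarrow>\<^sup>*\<^bsub>with_proj ?G\<^esub> (i, 0)"
      using step assms by auto
    moreover have "(i, 0) \<rightarrow>\<^sup>*\<^bsub>with_proj ?G\<^esub> (Suc i, a)"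
      using step assms by (auto intro!: arc simp: in_parcs_join_discrete_iff)
    ultimately show ?case by (rule reachable_trans)
  qed
  have "strongly_connected (with_proj ?G)"
    unfolding strongly_connected_def
  proof (intro conjI ballI)
    show "verts (with_proj ?G) \<noteq> {}"
      using assms by (auto simp: pverts_join_discrete lessThan_empty_iff)
    fix x y assume "x \<in> verts (with_proj ?G)" "y \<in> verts (with_proj ?G)"
    then show "x \<rightarrow>\<^sup>*\<^bsub>with_proj ?G\<^esub> y"
      by (cases x; cases y) (auto simp: pverts_join_discrete intro!: reachable_trans[OF sym base] base)
  qed
  then show ?thesis
    by (auto simp: connected_def strongly_connected_def reachable_mk_symmetric_eq[OF sym_arcs])
qed

end

theory Submission
  imports Defs
begin

text \<open>
  A shortest path is a walk whose length is the least one for which a walk between its ends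
  exists, and walks are counted by splitting off the first arc. Between layers at distance
  \<open>d \<ge> 1\<close> a shortest walk moves monotonically through the layers, so it is determined by its
  \<open>d - 1\<close> inner vertices and there are \<open>k ^ (d - 1)\<close> of them. Two vertices of the same layer are
  at distance 2, and the shortest paths between them correspond to their common neighbours, the
  vertices of the adjacent layers. The double sum over pairs of layers is evaluated by induction
  on \<open>t\<close>.
\<close>

section \<open>Counting walks of fixed length\<close>

definition walk_count :: "'a pair_pre_digraph \<Rightarrow> 'a \<Rightarrow> nat \<Rightarrow> 'a \<Rightarrow> nat" where
  "walk_count G u n v = card {p. pre_digraph.awalk (with_proj G) u p v \<and> length p = n}"

context pair_fin_digraph
begin

lemma finite_out_neighbours: "finite {w. (u, w) \<in> parcs G}"
  by (rule finite_subset[OF _ finite_imageI[OF pair_finite_arcs, of snd]]) force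

lemma finite_walks: "finite {p. awalk u p v \<and> length p = n}"
  by (rule finite_subset[OF _ finite_lists_length_eq[OF pair_finite_arcs, of n]])
     (auto simp: awalk_def)

lemma walk_count_eq_0_iff: "walk_count G u n v = 0 \<longleftrightarrow> (\<forall>p. awalk u p v \<longrightarrow> length p \<noteq> n)"
  using finite_walks[of u v n] by (auto simp: walk_count_def)

lemma walk_count_0: "walk_count G u 0 v = (if u = v \<and> u \<in> pverts G then 1 else 0)"
proof -
  have "{p. awalk u p v \<and> length p = 0} = (if u = v \<and> u \<in> pverts G then {[]} else {})"
    by (auto simp: awalk_Nil_iff)
  then show ?thesis
    by (auto simp: walk_count_def)
qed

lemma walk_count_Suc:
  "walk_count G u (Suc n) v = (\<Sum>w | (u, w) \<in> parcs G. walk_count G w n v)"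
proof -
  let ?W = "\<lambda>n u. {p. awalk u p v \<and> length p = n}"
  let ?N = "{w. (u, w) \<in> parcs G}"
  have "?W (Suc n) u = (\<lambda>(w, p). (u, w) # p) ` (SIGMA w:?N. ?W n w)"
    by (auto simp: awalk_Cons_iff length_Suc_conv image_iff)
  moreover have "inj_on (\<lambda>(w, p). (u, w) # p) (SIGMA w:?N. ?W n w)"
    by (auto simp: inj_on_def)
  ultimately have "card (?W (Suc n) u) = card (SIGMA w:?N. ?W n w)"
    by (simp add: card_image)
  also have "\<dots> = (\<Sum>w\<in>?N. card (?W n w))"
    using finite_walks by (simp add: card_SigmaI finite_out_neighbours)
  finally show ?thesis
    by (simp add: walk_count_def)
qed

lemma walk_count_1: "walk_count G u (Suc 0) v = (if (u, v) \<in> parcs G then 1 else 0)"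
proof -
  have "walk_count G u (Suc 0) v = (\<Sum>w | (u, w) \<in> parcs G. if w = v then 1 else 0)"
    unfolding walk_count_Suc by (rule sum.cong) (auto simp: walk_count_0 dest: wellformed')
  then show ?thesis
    by (simp add: finite_out_neighbours)
qed

text \<open>Cutting a closed subwalk out of a walk that repeats a vertex yields a shorter walk with
  the same ends. Hence every walk of least length is already a path.\<close>

lemma gpn_between_eq_walk_count:
  assumes "walk_count G u n v \<noteq> 0" and "\<And>m. m < n \<Longrightarrow> walk_count G u m v = 0"
  shows "gpn_between G u v = walk_count G u n v"
proof -
  have ge: "n \<le> length p" if "awalk u p v" for p
    using assms(2) that by (metis walk_count_eq_0_iff not_le)
  have apath: "apath u p v" if p: "awalk u p v" "length p = n" for p
  proof (rule ccontr)
    assume "\<not> apath u p v"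
    then have "\<not> distinct (awalk_verts u p)"
      using p by (simp add: apath_def)
    then obtain q r s w where "p = q @ r @ s" "0 < length r" "awalk u q w" "awalk w s v"
      using awalk_not_distinct_decomp[OF p(1)] by blast
    then show False
      using ge[of "q @ s"] p by auto
  qed
  \<comment> \<open>As a path of length \<open>n\<close>, \<open>p0\<close> is the competitor that
    keeps every shortest path from being longer than \<open>n\<close>.\<close>
  obtain p0 where p0: "awalk u p0 v" "length p0 = n"
    using assms(1) by (auto simp: walk_count_eq_0_iff)
  have "shortest_path G u p v \<longleftrightarrow> awalk u p v \<and> length p = n" for p
    using p0 apath ge apath[OF p0] unfolding shortest_path_def is_arg_min_def
    by (metis apath_def le_antisym not_le)
  then show ?thesis
    by (simp add: gpn_between_def walk_count_def)
qed

end

section \<open>Sums over unordered pairs\<close>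

text \<open>Each two-element set underlies exactly two ordered pairs, so grouping the ordered pairs
  by their underlying set counts it twice. The doubled form avoids division.\<close>

lemma sum_pairs_double:
  fixes f :: "'a set \<Rightarrow> 'b::comm_semiring_1"
  assumes "finite V"
  shows "2 * (\<Sum>e | e \<subseteq> V \<and> card e = 2. f e) =
    (\<Sum>u\<in>V. \<Sum>v\<in>V. if u = v then 0 else f {u, v})"
proof -
  let ?E = "{e. e \<subseteq> V \<and> card e = 2}" and ?P = "{(u, v) \<in> V \<times> V. u \<noteq> v}"
  let ?g = "\<lambda>(u, v). {u, v}"
  have fibre: "(\<Sum>p | p \<in> ?P \<and> ?g p = e. f (?g p)) = 2 * f e" if "e \<in> ?E" for e
  proof -
    from that obtain x y where e: "e = {x, y}" "x \<noteq> y"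
      by (auto simp: card_2_iff)
    then have "{p. p \<in> ?P \<and> ?g p = e} = {(x, y), (y, x)}"
      using that by (auto simp: doubleton_eq_iff)
    then show ?thesis
      using e by (simp add: insert_commute mult_2)
  qed
  have fin: "finite ?P"
    by (rule finite_subset[of _ "V \<times> V"]) (use assms in auto)
  have "2 * (\<Sum>e\<in>?E. f e) = (\<Sum>e\<in>?E. \<Sum>p | p \<in> ?P \<and> ?g p = e. f (?g p))"
    unfolding sum_distrib_left by (intro sum.cong refl fibre[symmetric])
  also have "\<dots> = (\<Sum>p\<in>?P. f (?g p))"
    by (rule sum.group) (use assms fin in auto)
  also have "\<dots> = (\<Sum>p\<in>V \<times> V. if fst p = snd p then 0 else f {fst p, snd p})"
    by (rule sum.mono_neutral_cong_left) (use assms in auto)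
  finally show ?thesis
    by (simp add: sum.cartesian_product case_prod_unfold)
qed

section \<open>Walks in the sequential join\<close>

abbreviation adjacent_layers :: "nat \<Rightarrow> nat \<Rightarrow> bool" where
  "adjacent_layers i j \<equiv> j = i + 1 \<or> i = j + 1"

lemma sum_neighbours_join_discrete:
  assumes "i \<in> {1..t}" "a < k"
  shows "(\<Sum>w | ((i, a), w) \<in> parcs (join_discrete k t). f w) =
    (\<Sum>j | j \<in> {1..t} \<and> adjacent_layers i j. \<Sum>c<k. f (j, c))"
proof -
  have "{w. ((i, a), w) \<in> parcs (join_discrete k t)} =
      {j. j \<in> {1..t} \<and> adjacent_layers i j} \<times> {..<k}"
    using assms by (auto simp: in_parcs_join_discrete_iff)
  then show ?thesis
    by (simp add: sum.cartesian_product)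
qed

text \<open>Each arc changes the layer index by exactly one, so \<open>n\<close> arcs climb at most
  \<open>n\<close> layers.\<close>

lemma walk_count_distant_layers:
  assumes "i + n < j"
  shows "walk_count (join_discrete k t) (i, a) n (j, b) = 0"
  using assms
proof (induction n arbitrary: i a)
  case 0
  interpret pair_graph "join_discrete k t" by (rule pair_graph_join_discrete)
  show ?case using 0 by (simp add: walk_count_0)
next
  case (Suc n)
  interpret pair_graph "join_discrete k t" by (rule pair_graph_join_discrete)
  show ?case
    unfolding walk_count_Suc
    using Suc by (intro sum.neutral) (auto simp: in_parcs_join_discrete_iff)
qed

text \<open>With as many arcs as layers to climb, no step can go back, and each of the
  \<open>n\<close> inner vertices is a free choice among the \<open>k\<close> vertices of its
  layer.\<close>

lemma walk_count_monotone:
  assumes "i \<ge> 1" "i + Suc n \<le> t" "a < k" "b < k"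
  shows "walk_count (join_discrete k t) (i, a) (Suc n) (i + Suc n, b) = k ^ n"
  using assms
proof (induction n arbitrary: i a)
  case 0
  interpret pair_graph "join_discrete k t" by (rule pair_graph_join_discrete)
  show ?case using 0 by (simp add: walk_count_1 in_parcs_join_discrete_iff)
next
  case (Suc n)
  interpret pair_graph "join_discrete k t" by (rule pair_graph_join_discrete)
  let ?j = "i + Suc (Suc n)"
  let ?f = "\<lambda>w. walk_count (join_discrete k t) w (Suc n) (?j, b)"
  have "walk_count (join_discrete k t) (i, a) (Suc (Suc n)) (?j, b) =
      (\<Sum>j | j \<in> {1..t} \<and> adjacent_layers i j. \<Sum>c<k. ?f (j, c))"
    unfolding walk_count_Suc[of _ "Suc n"]
    by (rule sum_neighbours_join_discrete) (use Suc.prems in auto)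
  \<comment> \<open>From layer \<open>i - 1\<close> the target is \<open>n + 3\<close> layers away,
    but only \<open>n + 1\<close> arcs remain.\<close>
  also have "\<dots> = (\<Sum>j\<in>{i + 1}. \<Sum>c<k. ?f (j, c))"
    by (rule sum.mono_neutral_right)
       (use Suc.prems in \<open>auto intro!: walk_count_distant_layers\<close>)
  also have "\<dots> = k ^ Suc n"
    using Suc.IH[of "i + 1"] Suc.prems by simp
  finally show ?case .
qed

section \<open>Numbers of shortest paths\<close>

lemma gpn_between_layers_less:
  assumes "1 \<le> i" "i < j" "j \<le> t" "a < k" "b < k"
  shows "gpn_between (join_discrete k t) (i, a) (j, b) = k ^ (j - i - 1)"
proof -
  interpret pair_graph "join_discrete k t" by (rule pair_graph_join_discrete)
  obtain n where n: "j = i + Suc n"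
    using assms(2) less_imp_Suc_add by auto
  have *: "walk_count (join_discrete k t) (i, a) (Suc n) (j, b) = k ^ n"
    unfolding n by (rule walk_count_monotone) (use assms n in auto)
  have "gpn_between (join_discrete k t) (i, a) (j, b) =
      walk_count (join_discrete k t) (i, a) (Suc n) (j, b)"
    by (rule gpn_between_eq_walk_count)
       (use * assms n in \<open>auto intro: walk_count_distant_layers\<close>)
  then show ?thesis
    using * n by simp
qed

text \<open>In truncated subtraction one of \<open>i - j\<close> and \<open>j - i\<close> is 0, so
  their sum is the distance of the layers. The case \<open>j < i\<close> follows by reversing
  paths.\<close>

lemma gpn_between_layers_neq:
  assumes "i \<in> {1..t}" "j \<in> {1..t}" "i \<noteq> j" "a < k" "b < k"
  shows "gpn_between (join_discrete k t) (i, a) (j, b) = k ^ ((i - j) + (j - i) - 1)"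
proof -
  interpret pair_graph "join_discrete k t" by (rule pair_graph_join_discrete)
  show ?thesis
  proof (cases "i < j")
    case True
    then show ?thesis using gpn_between_layers_less[of i j t a k b] assms by simp
  next
    case False
    then show ?thesis
      using gpn_between_layers_less[of j i t b k a] assms by (simp add: gpn_between_sym[of "(i, a)"])
  qed
qed

text \<open>The number of adjacent layers is 1 for the two outer layers and 2 for the others.
  Leaving it as a cardinality avoids this case distinction, and it later becomes a sum over
  layers.\<close>

lemma gpn_between_same_layer:
  assumes "t \<ge> 2" "i \<in> {1..t}" "a < k" "b < k" "a \<noteq> b"
  shows "gpn_between (join_discrete k t) (i, a) (i, b) =
    k * card {j. j \<in> {1..t} \<and> adjacent_layers i j}"
proof -
  interpret pair_graph "join_discrete k t" by (rule pair_graph_join_discrete)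
  let ?N = "{j. j \<in> {1..t} \<and> adjacent_layers i j}"
  let ?w = "\<lambda>n. walk_count (join_discrete k t) (i, a) n (i, b)"
  have "?w (Suc (Suc 0)) = (\<Sum>j\<in>?N. \<Sum>c<k. walk_count (join_discrete k t) (j, c) (Suc 0) (i, b))"
    unfolding walk_count_Suc[of _ "Suc 0"]
    by (rule sum_neighbours_join_discrete) (use assms in auto)
  also have "\<dots> = (\<Sum>j\<in>?N. \<Sum>c<k. 1)"
    using assms by (intro sum.cong refl) (auto simp: walk_count_1 in_parcs_join_discrete_iff)
  finally have w2: "?w (Suc (Suc 0)) = k * card ?N"
    by simp
  \<comment> \<open>Since \<open>t \<ge> 2\<close>, some adjacent layer exists, so walks of length 2
    exist and 2 is the least length.\<close>
  have "(if i = 1 then 2 else i - 1) \<in> ?N"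
    using assms by auto
  then have "card ?N \<noteq> 0"
    by (subst card_0_eq) auto
  moreover have "?w m = 0" if "m < Suc (Suc 0)" for m
    using that assms
    by (auto simp: less_Suc_eq walk_count_0 walk_count_1 in_parcs_join_discrete_iff)
  ultimately show ?thesis
    using gpn_between_eq_walk_count[of "(i, a)" "Suc (Suc 0)" "(i, b)"] w2 assms by simp
qed

section \<open>Summation over pairs of layers\<close>

text \<open>
  The shortest paths inside layer \<open>i\<close> that pass through layer \<open>j\<close> are charged to the pair
  \<open>(i, j)\<close>.
\<close>

definition layer_weight :: "nat \<Rightarrow> nat \<Rightarrow> nat \<Rightarrow> nat" where
  "layer_weight k i j =
     (if i = j then 0 else k ^ ((i - j) + (j - i) + 1)) +
     (if adjacent_layers i j then (k - 1) * k ^ 2 else 0)"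

text \<open>Two layers at distance \<open>d \<ge> 1\<close> span \<open>k ^ 2\<close> vertex pairs
  with \<open>k ^ (d - 1)\<close> shortest paths each, in total \<open>k ^ (d + 1)\<close>. The
  \<open>k * (k - 1)\<close> ordered pairs inside a layer have \<open>k\<close> shortest paths each
  through every adjacent layer, in total \<open>(k - 1) * k ^ 2\<close>.\<close>

lemma gpn_pairs_double:
  assumes "t \<ge> 2"
  shows "2 * (\<Sum>e | e \<subseteq> pverts (join_discrete k t) \<and> card e = 2. gpn_pair (join_discrete k t) e) =
    (\<Sum>i\<in>{1..t}. \<Sum>j\<in>{1..t}. layer_weight k i j)"
proof -
  let ?G = "join_discrete k t"
  interpret pair_graph ?G by (rule pair_graph_join_discrete)
  let ?h = "\<lambda>u v. if u = v then 0 else gpn_between ?G u v"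
  have diag: "(\<Sum>b<k. ?h (i, a) (i, b)) =
      (\<Sum>j\<in>{1..t}. if adjacent_layers i j then (k - 1) * k else 0)"
    if "i \<in> {1..t}" "a < k" for i a
  proof -
    have "(\<Sum>b<k. ?h (i, a) (i, b)) =
        (\<Sum>b\<in>{..<k} - {a}. k * card {j. j \<in> {1..t} \<and> adjacent_layers i j})"
      by (rule sum.mono_neutral_cong_right)
         (use that assms in \<open>auto simp: gpn_between_same_layer\<close>)
    also have "\<dots> = (\<Sum>j | j \<in> {1..t} \<and> adjacent_layers i j. (k - 1) * k)"
      using that by simp
    also have "\<dots> = (\<Sum>j\<in>{1..t}. if adjacent_layers i j then (k - 1) * k else 0)"
      by (rule sum.mono_neutral_cong_left) auto
    finally show ?thesis .
  qed
  have off: "(\<Sum>b<k. ?h (i, a) (j, b)) = k ^ ((i - j) + (j - i))"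
    if "i \<in> {1..t}" "a < k" "j \<in> {1..t}" "i \<noteq> j" for i j a
  proof -
    have "(\<Sum>b<k. ?h (i, a) (j, b)) = (\<Sum>b<k. k ^ ((i - j) + (j - i) - 1))"
      by (rule sum.cong) (use that in \<open>auto simp: gpn_between_layers_neq\<close>)
    also have "\<dots> = k ^ Suc ((i - j) + (j - i) - 1)"
      by simp
    \<comment> \<open>The distance is positive because \<open>i \<noteq> j\<close>, so subtracting 1
      does not truncate.\<close>
    also have "Suc ((i - j) + (j - i) - 1) = (i - j) + (j - i)"
      using that by auto
    finally show ?thesis .
  qed
  \<comment> \<open>The factor \<open>k\<close> stands for the \<open>k\<close> vertices
    \<open>a\<close> of layer \<open>i\<close>, which all have the same total.\<close>
  have vertex: "k * (\<Sum>j\<in>{1..t}. \<Sum>b<k. ?h (i, a) (j, b)) = (\<Sum>j\<in>{1..t}. layer_weight k i j)"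
    if "i \<in> {1..t}" "a < k" for i a
  proof -
    have "(\<Sum>j\<in>{1..t}. \<Sum>b<k. ?h (i, a) (j, b)) =
        (\<Sum>b<k. ?h (i, a) (i, b)) + (\<Sum>j\<in>{1..t} - {i}. \<Sum>b<k. ?h (i, a) (j, b))"
      by (rule sum.remove) (use that in auto)
    also have "(\<Sum>j\<in>{1..t} - {i}. \<Sum>b<k. ?h (i, a) (j, b)) =
        (\<Sum>j\<in>{1..t}. if i = j then 0 else k ^ ((i - j) + (j - i)))"
      by (rule sum.mono_neutral_cong_left) (use that off in auto)
    finally have split: "(\<Sum>j\<in>{1..t}. \<Sum>b<k. ?h (i, a) (j, b)) =
        (\<Sum>j\<in>{1..t}. (if adjacent_layers i j then (k - 1) * k else 0) +
          (if i = j then 0 else k ^ ((i - j) + (j - i))))"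
      unfolding diag[OF that] sum.distrib .
    show ?thesis
      unfolding split layer_weight_def sum_distrib_left
      by (rule sum.cong) (auto simp: power2_eq_square algebra_simps)
  qed
  have layer: "(\<Sum>a<k. \<Sum>j\<in>{1..t}. \<Sum>b<k. ?h (i, a) (j, b)) = (\<Sum>j\<in>{1..t}. layer_weight k i j)"
    if "i \<in> {1..t}" for i
  proof (cases "k = 0")
    case True
    then show ?thesis by (simp add: layer_weight_def)
  next
    case False
    \<comment> \<open>Scaling by \<open>k\<close> makes \<open>vertex\<close> applicable to each
      summand; the factor cancels afterwards.\<close>
    have "k * (\<Sum>a<k. \<Sum>j\<in>{1..t}. \<Sum>b<k. ?h (i, a) (j, b)) =
        (\<Sum>a<k. \<Sum>j\<in>{1..t}. layer_weight k i j)"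
      unfolding sum_distrib_left[of k _ "{..<k}"]
      by (rule sum.cong) (use vertex that in auto)
    then show ?thesis
      using False by simp
  qed
  have "2 * (\<Sum>e | e \<subseteq> pverts ?G \<and> card e = 2. gpn_pair ?G e) =
      (\<Sum>u\<in>pverts ?G. \<Sum>v\<in>pverts ?G. ?h u v)"
    unfolding sum_pairs_double[OF pair_finite_verts] gpn_pair_eq ..
  also have "\<dots> = (\<Sum>i\<in>{1..t}. \<Sum>a<k. \<Sum>j\<in>{1..t}. \<Sum>b<k. ?h (i, a) (j, b))"
    unfolding pverts_join_discrete by (simp only: sum.cartesian_product')
  also have "\<dots> = (\<Sum>i\<in>{1..t}. \<Sum>j\<in>{1..t}. layer_weight k i j)"
    by (rule sum.cong) (use layer in auto)
  finally show ?thesis .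
qed

text \<open>The distances to layer \<open>Suc t\<close> run from 1 to \<open>t\<close> and give a
  geometric sum starting at \<open>k ^ 2\<close>; only layer \<open>t\<close> is adjacent and adds
  \<open>(k - 1) * k ^ 2\<close>.\<close>

lemma sum_layer_weight_last:
  assumes "k \<ge> 2" "t \<ge> 1"
  shows "real (\<Sum>i\<in>{1..t}. layer_weight k i (Suc t)) =
    (real k ^ (t + 2) + real k ^ 3 * (real k - 2)) / (real k - 1)"
proof -
  have "(\<Sum>i\<in>{1..t}. layer_weight k i (Suc t)) =
      (\<Sum>i\<in>{1..t}. k ^ (t + 1 - i + 1)) + (\<Sum>i\<in>{1..t}. if i = t then (k - 1) * k ^ 2 else 0)"
    unfolding layer_weight_def sum.distrib
    by (intro arg_cong2[of _ _ _ _ "(+)"] sum.cong) auto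
  also have "(\<Sum>i\<in>{1..t}. k ^ (t + 1 - i + 1)) = (\<Sum>m<t. k ^ (m + 2))"
    by (rule sum.reindex_bij_witness[of _ "\<lambda>m. t - m" "\<lambda>i. t - i"]) (auto simp: Suc_diff_le)
  also have "(\<Sum>i\<in>{1..t}. if i = t then (k - 1) * k ^ 2 else 0) = (k - 1) * k ^ 2"
    using assms by simp
  finally have "real (\<Sum>i\<in>{1..t}. layer_weight k i (Suc t)) =
      real k ^ 2 * (\<Sum>m<t. real k ^ m) + (real k - 1) * real k ^ 2"
    using assms by (simp add: of_nat_diff sum_distrib_left power2_eq_square mult_ac)
  also have "(\<Sum>m<t. real k ^ m) = (real k ^ t - 1) / (real k - 1)"
    using assms by (subst geometric_sum) auto
  finally show ?thesis
    using assms by (simp add: field_simps power_add power2_eq_square power3_eq_cube)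
qed

text \<open>A new layer adds a row and a column of equal sum and a zero corner. The induction can
  start at \<open>t = 1\<close>, where both sides vanish.\<close>

lemma sum_layer_weight:
  assumes "k \<ge> 2" "t \<ge> 1"
  shows "real (\<Sum>i\<in>{1..t}. \<Sum>j\<in>{1..t}. layer_weight k i j) =
    2 * (1 / (real k - 1) *
      ((real k ^ (t + 2) - real k ^ 3) / (real k - 1) + real k ^ 3 * (real k - 2) * (real t - 1)))"
  using assms(2)
proof (induction t rule: dec_induct)
  case base
  then show ?case by (simp add: layer_weight_def numeral_3_eq_3)
next
  case (step t)
  have sym: "layer_weight k i j = layer_weight k j i" for i j
    by (auto simp: layer_weight_def add.commute)
  have row: "(\<Sum>j\<in>{1..t}. layer_weight k (Suc t) j) = (\<Sum>i\<in>{1..t}. layer_weight k i (Suc t))"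
    by (rule sum.cong[OF refl sym])
  have "layer_weight k (Suc t) (Suc t) = 0"
    by (simp add: layer_weight_def)
  then have "(\<Sum>i\<in>{1..Suc t}. \<Sum>j\<in>{1..Suc t}. layer_weight k i j) =
      (\<Sum>i\<in>{1..t}. \<Sum>j\<in>{1..t}. layer_weight k i j) +
      2 * (\<Sum>i\<in>{1..t}. layer_weight k i (Suc t))"
    using row by (simp add: sum.distrib)
  then have "real (\<Sum>i\<in>{1..Suc t}. \<Sum>j\<in>{1..Suc t}. layer_weight k i j) =
      real (\<Sum>i\<in>{1..t}. \<Sum>j\<in>{1..t}. layer_weight k i j) +
      2 * real (\<Sum>i\<in>{1..t}. layer_weight k i (Suc t))"
    by (metis of_nat_add of_nat_mult of_nat_numeral)
  \<comment> \<open>Free variables shield the powers from \<open>field_simps\<close>. With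
    \<open>c\<close> as \<open>real k - 1\<close>, the factor \<open>c + 1\<close> raises the
    exponent of \<open>A\<close> by one.\<close>
  moreover have "2 * (1 / c * ((A - B) / c + D * (s - 1))) + 2 * ((A + D) / c) =
      2 * (1 / c * (((c + 1) * A - B) / c + D * s))" if "c \<noteq> 0" for A B D c s :: real
    using that by (simp add: field_simps)
  from this[of "real k - 1" "real k ^ (t + 2)" "real k ^ 3" "real k ^ 3 * (real k - 2)" "real t"]
  have "2 * (1 / (real k - 1) *
        ((real k ^ (t + 2) - real k ^ 3) / (real k - 1) + real k ^ 3 * (real k - 2) * (real t - 1))) +
      2 * ((real k ^ (t + 2) + real k ^ 3 * (real k - 2)) / (real k - 1)) =
      2 * (1 / (real k - 1) *
        ((real k ^ (Suc t + 2) - real k ^ 3) / (real k - 1) +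
          real k ^ 3 * (real k - 2) * (real (Suc t) - 1)))"
    using assms(1) by simp
  ultimately show ?case
    unfolding step.IH sum_layer_weight_last[OF assms(1) step.hyps(1)] by (rule trans)
qed

theorem proposition3:
  fixes k t :: nat
  assumes "k \<ge> 2" and "t \<ge> 2"
  shows "real (gpn (join_discrete k t)) =
    1 / (real k - 1) *
      ((real k ^ (t + 2) - real k ^ 3) / (real k - 1) + real k ^ 3 * (real k - 2) * (real t - 1))
    + real k * real t"
proof -
  let ?S = "\<Sum>e | e \<subseteq> pverts (join_discrete k t) \<and> card e = 2. gpn_pair (join_discrete k t) e"
  have "2 * real ?S = real (\<Sum>i\<in>{1..t}. \<Sum>j\<in>{1..t}. layer_weight k i j)"
    unfolding gpn_pairs_double[OF assms(2), symmetric] by simp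
  also have "\<dots> = 2 * (1 / (real k - 1) *
      ((real k ^ (t + 2) - real k ^ 3) / (real k - 1) + real k ^ 3 * (real k - 2) * (real t - 1)))"
    by (rule sum_layer_weight) (use assms in auto)
  finally have "real ?S = 1 / (real k - 1) *
      ((real k ^ (t + 2) - real k ^ 3) / (real k - 1) + real k ^ 3 * (real k - 2) * (real t - 1))"
    by (subst (asm) mult_left_cancel) auto
  then show ?thesis
    by (simp only: gpn_def pverts_join_discrete of_nat_add)
       (simp add: card_cartesian_product mult.commute)
qed

end
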